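(* Let $n$ be a positive integer and let $\mu=(\mu_1,\dots,\mu_n)$ and $\nu=(\nu_1,\dots,\nu_n)$ be partitions of length at most $n$. Let $\delta=(n-1,n-2,\ldots,1,0)$ and let $w_0$ be the longest element of $S_n$. Then for every integer $k$ with $0\le k\le \binom{n}{2}$, the symmetric polynomial $$t_{\mu,\nu}^{k}=(-1)^{k}\sum_{w\in S_n,\ \ell(w)\ge k}(-1)^{\ell(w)}\,h_{\mu+\delta+w(w_0\nu-\delta)}$$ is Schur positive.
   Context: A partition of length at most $n$ is written as a weakly decreasing sequence of $n$ non-negative integers (padded with zeros). The symmetric group $S_n$ acts on $\mathbb{Z}^n$ by permuting coordinates, so $w_0\nu=(\nu_n,\ldots,\nu_1)$; $\ell(w)$ is the number of inversions of $w$. All symmetric polynomials are in $n$ variables $x_1,\dots,x_n$. For an integer $r$, $h_r$ denotes the complete homogeneous symmetric polynomial of degree $r$, with $h_0=1$ and $h_r=0$ for $r<0$; for $\tau=(\tau_1,\dots,\tau_n)\in\mathbb{Z}^n$, $h_\tau=h_{\tau_1}h_{\tau_2}\cdots h_{\tau_n}$. For a partition $\lambda$ of length at most $n$, $s_\lambda$ is the Schur polynomial in $n$ variables. A symmetric polynomial is Schur positive if it is a linear combination of Schur polynomials $s_\lambda$ with non-negative coefficients. *)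

theory Defs
  imports "HOL-Combinatorics.Permutations" "HOL-Library.Poly_Mapping" "HOL-Library.FuncSet"
begin

text \<open>
  Coordinates, variables and tableau entries are indexed by \<open>0, \<dots>, n - 1\<close>.
  Vectors in \<open>\<int>\<^sup>n\<close> are functions \<open>nat \<Rightarrow> int\<close> of which only the values below \<open>n\<close> matter.
\<close>

type_synonym int_mpoly = "(nat \<Rightarrow>\<^sub>0 nat) \<Rightarrow>\<^sub>0 int"

definition X :: "nat \<Rightarrow> int_mpoly" where
  "X i = Poly_Mapping.single (Poly_Mapping.single i 1) 1"

text \<open>Padding by zeros makes the representation of a partition unique.\<close>

definition is_partition :: "nat \<Rightarrow> (nat \<Rightarrow> nat) \<Rightarrow> bool" where
  "is_partition n lam \<longleftrightarrow> (\<forall>i j. i \<le> j \<longrightarrow> lam j \<le> lam i) \<and> (\<forall>i\<ge>n. lam i = 0)"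

definition complete_h :: "nat \<Rightarrow> int \<Rightarrow> int_mpoly" where
  "complete_h n r =
     (\<Sum>a | a \<in> {..<n} \<rightarrow>\<^sub>E UNIV \<and> int (\<Sum>i<n. a i) = r. \<Prod>i<n. X i ^ a i)"

lemma finite_exponents:
  "finite {a \<in> {..<n::nat} \<rightarrow>\<^sub>E (UNIV :: nat set). int (\<Sum>i<n. a i) = r}"
proof (rule finite_subset)
  show "{a \<in> {..<n::nat} \<rightarrow>\<^sub>E (UNIV :: nat set). int (\<Sum>i<n. a i) = r} \<subseteq> {..<n} \<rightarrow>\<^sub>E {..nat r}"
  proof
    fix a :: "nat \<Rightarrow> nat"
    assume "a \<in> {a \<in> {..<n::nat} \<rightarrow>\<^sub>E (UNIV :: nat set). int (\<Sum>i<n. a i) = r}"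
    then have a: "a \<in> {..<n} \<rightarrow>\<^sub>E UNIV" and r: "int (\<Sum>i<n. a i) = r"
      by blast+
    have r': "(\<Sum>i<n. a i) = nat r"
      unfolding r[symmetric] by (rule nat_int[symmetric])
    have "a i \<in> {..nat r}" if "i \<in> {..<n}" for i
      unfolding r'[symmetric] atMost_iff using that by (intro member_le_sum) simp_all
    moreover have "a i = undefined" if "i \<notin> {..<n}" for i
      using a that by (rule PiE_arb)
    ultimately show "a \<in> {..<n} \<rightarrow>\<^sub>E {..nat r}" by (rule PiE_I)
  qed
qed (rule finite_PiE, simp_all)

lemma complete_h_neg: "r < 0 \<Longrightarrow> complete_h n r = 0"
proof -
  assume "r < 0"
  then have "{a \<in> {..<n::nat} \<rightarrow>\<^sub>E (UNIV :: nat set). int (\<Sum>i<n. a i) = r} = {}"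
    by (auto simp del: of_nat_sum)
  then show ?thesis unfolding complete_h_def by (simp only: sum.empty)
qed

lemma complete_h_0: "complete_h n 0 = 1"
proof -
  have "{a \<in> {..<n::nat} \<rightarrow>\<^sub>E (UNIV :: nat set). int (\<Sum>i<n. a i) = 0} = {\<lambda>i\<in>{..<n}. 0}"
    by (auto simp: PiE_iff fun_eq_iff extensional_def simp del: of_nat_sum)
  then show ?thesis by (simp add: complete_h_def del: of_nat_sum)
qed

definition h_vec :: "nat \<Rightarrow> (nat \<Rightarrow> int) \<Rightarrow> int_mpoly" where
  "h_vec n tau = (\<Prod>i<n. complete_h n (tau i))"

text \<open>Schur polynomials as generating functions of semistandard Young tableaux.\<close>

definition cells :: "nat \<Rightarrow> (nat \<Rightarrow> nat) \<Rightarrow> (nat \<times> nat) set" where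
  "cells n lam = {(i, j). i < n \<and> j < lam i}"

definition ssyt :: "nat \<Rightarrow> (nat \<Rightarrow> nat) \<Rightarrow> (nat \<times> nat \<Rightarrow> nat) set" where
  "ssyt n lam = {T \<in> cells n lam \<rightarrow>\<^sub>E {..<n}.
     (\<forall>i j. (i, j) \<in> cells n lam \<longrightarrow> (i, Suc j) \<in> cells n lam \<longrightarrow> T (i, j) \<le> T (i, Suc j)) \<and>
     (\<forall>i j. (i, j) \<in> cells n lam \<longrightarrow> (Suc i, j) \<in> cells n lam \<longrightarrow> T (i, j) < T (Suc i, j))}"

definition schur :: "nat \<Rightarrow> (nat \<Rightarrow> nat) \<Rightarrow> int_mpoly" where
  "schur n lam = (\<Sum>T\<in>ssyt n lam. \<Prod>c\<in>cells n lam. X (T c))"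

lemma finite_cells: "finite (cells n lam)"
proof -
  have "cells n lam = (SIGMA i:{..<n}. {..<lam i})" by (auto simp: cells_def)
  then show ?thesis by simp
qed

lemma finite_ssyt: "finite (ssyt n lam)"
  unfolding ssyt_def
  by (intro finite_Collect_conjI disjI1, simp only: Collect_mem_eq, intro finite_PiE finite_cells finite_lessThan)

definition schur_positive :: "nat \<Rightarrow> int_mpoly \<Rightarrow> bool" where
  "schur_positive n p \<longleftrightarrow>
     (\<exists>L c. finite L \<and> (\<forall>lam\<in>L. is_partition n lam \<and> (0 :: int) \<le> c lam) \<and>
        p = (\<Sum>lam\<in>L. of_int (c lam) * schur n lam))"

definition perm_length :: "nat \<Rightarrow> (nat \<Rightarrow> nat) \<Rightarrow> nat" where
  "perm_length n w = card {(i, j). i < j \<and> j < n \<and> w j < w i}"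

definition perm_act :: "(nat \<Rightarrow> nat) \<Rightarrow> (nat \<Rightarrow> int) \<Rightarrow> nat \<Rightarrow> int" where
  "perm_act w v = (\<lambda>i. v (inv w i))"

lemma perm_act_compose:
  assumes "u permutes {..<n}" "w permutes {..<n}"
  shows "perm_act (u \<circ> w) v = perm_act u (perm_act w v)"
  by (simp add: perm_act_def o_inv_distrib[OF permutes_bij[OF assms(1)] permutes_bij[OF assms(2)]])

definition longest_perm :: "nat \<Rightarrow> nat \<Rightarrow> nat" where
  "longest_perm n i = (if i < n then n - 1 - i else i)"

lemma longest_perm_invol: "longest_perm n (longest_perm n i) = i"
  by (auto simp: longest_perm_def)

lemma longest_perm_permutes: "longest_perm n permutes {..<n}"
proof (rule bij_imp_permutes)
  show "bij_betw (longest_perm n) {..<n} {..<n}"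
    by (rule bij_betw_byWitness[where f' = "longest_perm n"])
      (auto simp: longest_perm_invol, auto simp: longest_perm_def)
qed (simp add: longest_perm_def)

lemma perm_length_le_longest: "perm_length n w \<le> perm_length n (longest_perm n)"
proof -
  have "finite {(i, j). i < j \<and> j < n \<and> longest_perm n j < longest_perm n i}"
    by (rule finite_subset[of _ "{..<n} \<times> {..<n}"]) auto
  then show ?thesis
    unfolding perm_length_def by (intro card_mono) (auto simp: longest_perm_def)
qed

lemma perm_act_longest: "i < n \<Longrightarrow> perm_act (longest_perm n) v i = v (n - 1 - i)"
proof -
  assume "i < n"
  have "inv (longest_perm n) = longest_perm n"
    by (rule inv_unique_comp) (auto simp: longest_perm_invol)
  with \<open>i < n\<close> show ?thesis by (simp add: perm_act_def longest_perm_def)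
qed

definition delta :: "nat \<Rightarrow> nat \<Rightarrow> int" where
  "delta n i = int n - 1 - int i"

definition truncated_sum :: "nat \<Rightarrow> (nat \<Rightarrow> nat) \<Rightarrow> (nat \<Rightarrow> nat) \<Rightarrow> nat \<Rightarrow> int_mpoly" where
  "truncated_sum n mu nu k =
     (-1) ^ k * (\<Sum>w | w permutes {..<n} \<and> k \<le> perm_length n w.
       (-1) ^ perm_length n w *
       h_vec n (\<lambda>i. int (mu i) + delta n i +
         perm_act w (\<lambda>j. perm_act (longest_perm n) (\<lambda>l. int (nu l)) j - delta n j) i))"

end

theory Submission
  imports Defs
begin

text \<open>
  By the Pieri rule, \<open>h\<^sub>\<tau>\<close> is the sum of \<open>s\<^bsub>shape T\<^esub>\<close> over all semistandard tableaux \<open>T\<close> of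
  content \<open>\<tau>\<close> (lemma \<open>prod_complete_h_eq_sum_chains\<close>). The truncated sum is therefore a signed sum of
  Schur polynomials over pairs \<open>(w, T)\<close> where \<open>T\<close> has content \<open>\<mu> + \<delta> + w(w\<^sub>0\<nu> - \<delta>)\<close>, and it suffices
  to cancel all negative terms.

  Read \<open>T\<close> column by column from the left and follow the vector \<open>\<mu> + \<delta> - (content read so far)\<close>. It
  starts at the strictly dominant vector \<open>\<mu> + \<delta>\<close> and ends at \<open>w(\<delta> - w\<^sub>0\<nu>)\<close>. A column contains each
  letter at most once, so the vector cannot jump across a wall of the dominant chamber: if it ever
  stops being strictly dominant, then the first time it lies on a wall \<open>x\<^sub>i = x\<^bsub>i+1\<^esub>\<close> (lemma
  \<open>gap_exit\<close>). The Bender-Knuth involution for the letters \<open>i\<close>, \<open>i + 1\<close>, applied to the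
  columns not yet read, reflects the rest of the path in that wall. The result is again
  semistandard, has the same shape and leaves the chamber at the same place, and its content belongs
  to \<open>s\<^sub>iw\<close> in place of \<open>w\<close> (lemmas \<open>reflect_in_chains\<close>, \<open>reflect_reflect\<close>). If the path never
  leaves the chamber, then its endpoint \<open>w(\<delta> - w\<^sub>0\<nu>)\<close> is strictly dominant, so \<open>w = 1\<close>.

  Left multiplication by a simple reflection changes \<open>\<ell>(w)\<close> by exactly one. This is what makes
  truncation harmless: under the constraint \<open>\<ell>(w) \<ge> k\<close> the only pairs that lose their partner are
  those with \<open>\<ell>(w) = k\<close> whose partner has length \<open>k - 1\<close>, and their sign \<open>(-1)\<^bsup>k+\<ell>(w)\<^esup>\<close> is positive
  (lemma \<open>truncated_cancellation\<close>).

  Tableaux are handled as chains of partitions in which consecutive members differ by a horizontal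
  strip, that is, as Gelfand-Tsetlin patterns: the member with index \<open>i + 1\<close> is the shape occupied by
  the letters \<open>0, \<dots>, i\<close>. Then restricting to the first \<open>j\<close> columns means replacing every part by its
  minimum with \<open>j\<close>, and the Bender-Knuth involution reflects the parts of a single partition in the
  intervals that its two neighbours allow. The Pieri rule is proved by induction on the number of
  variables, by a reflection of the same kind.
\<close>

section \<open>Horizontal strips\<close>

definition hstrip :: "(nat \<Rightarrow> nat) \<Rightarrow> (nat \<Rightarrow> nat) \<Rightarrow> bool" where
  "hstrip kap lam \<longleftrightarrow> (\<forall>i. kap i \<le> lam i \<and> lam (Suc i) \<le> kap i)"

definition psize :: "nat \<Rightarrow> (nat \<Rightarrow> nat) \<Rightarrow> nat" where
  "psize n lam = (\<Sum>i<n. lam i)"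

definition strips_down :: "nat \<Rightarrow> (nat \<Rightarrow> nat) \<Rightarrow> (nat \<Rightarrow> nat) set" where
  "strips_down n lam = {kap. hstrip kap lam \<and> (\<forall>i\<ge>n. kap i = 0)}"

definition strips_up :: "nat \<Rightarrow> (nat \<Rightarrow> nat) \<Rightarrow> int \<Rightarrow> (nat \<Rightarrow> nat) set" where
  "strips_up n lam r =
     {rho. hstrip lam rho \<and> (\<forall>i\<ge>n. rho i = 0) \<and> int (psize n rho) = int (psize n lam) + r}"

text \<open>
  The two partitions of a strip interlace, which forces both to be weakly decreasing.
\<close>

lemma hstrip_antimono:
  assumes "hstrip kap lam" "i \<le> j"
  shows "kap j \<le> kap i" "lam j \<le> lam i"
proof -
  have "kap (Suc m) \<le> kap m" "lam (Suc m) \<le> lam m" for m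
    using assms(1) unfolding hstrip_def by (meson order_trans)+
  then show "kap j \<le> kap i" "lam j \<le> lam i"
    using assms(2) by (auto intro: lift_Suc_antimono_le)
qed

lemma strips_down_partition: "kap \<in> strips_down n lam \<Longrightarrow> is_partition n kap"
  using hstrip_antimono by (auto simp: strips_down_def is_partition_def)

lemma strips_up_partition: "rho \<in> strips_up n lam r \<Longrightarrow> is_partition n rho"
  using hstrip_antimono by (auto simp: strips_up_def is_partition_def)

lemma finite_bounded_rows: "finite {f :: nat \<Rightarrow> nat. (\<forall>i<n. f i \<le> b) \<and> (\<forall>i\<ge>n. f i = 0)}"
proof -
  have "finite {f :: nat \<Rightarrow> nat. \<forall>i. (i \<in> {..<n} \<longrightarrow> f i \<in> {..b}) \<and> (i \<notin> {..<n} \<longrightarrow> f i = 0)}"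
    by (rule finite_set_of_finite_funs) auto
  then show ?thesis
    by (rule rev_finite_subset) auto
qed

lemma part_le_psize: "i < n \<Longrightarrow> lam i \<le> psize n lam"
  unfolding psize_def by (rule member_le_sum) auto

lemma finite_strips_up: "finite (strips_up n lam r)"
proof (rule finite_subset)
  show "strips_up n lam r \<subseteq>
      {f. (\<forall>i<n. f i \<le> nat (int (psize n lam) + r)) \<and> (\<forall>i\<ge>n. f i = 0)}"
  proof
    fix f assume f: "f \<in> strips_up n lam r"
    then have "int (psize n f) = int (psize n lam) + r"
      by (simp add: strips_up_def)
    then have "psize n f = nat (int (psize n lam) + r)"
      by (metis nat_int)
    with f part_le_psize[of _ n f]
    show "f \<in> {f. (\<forall>i<n. f i \<le> nat (int (psize n lam) + r)) \<and> (\<forall>i\<ge>n. f i = 0)}"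
      by (auto simp: strips_up_def)
  qed
qed (rule finite_bounded_rows)

lemma finite_strips_down: "finite (strips_down n lam)"
proof (rule finite_subset)
  show "strips_down n lam \<subseteq> {f. (\<forall>i<n. f i \<le> psize n lam) \<and> (\<forall>i\<ge>n. f i = 0)}"
    using order_trans[OF _ part_le_psize[of _ n lam]] by (auto simp: strips_down_def hstrip_def)
qed (rule finite_bounded_rows)

section \<open>Branching in the last variable\<close>

lemma card_cells: "card (cells n lam) = psize n lam"
proof -
  have "cells n lam = (SIGMA i:{..<n}. {..<lam i})" by (auto simp: cells_def)
  then show ?thesis by (simp add: psize_def)
qed

lemma ssyt_row_mono:
  assumes T: "T \<in> ssyt n lam" and "r < n" "j \<le> j'" "j' < lam r"
  shows "T (r, j) \<le> T (r, j')"
  using \<open>j \<le> j'\<close> \<open>j' < lam r\<close>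
proof (induction rule: dec_induct)
  case (step m)
  then have "T (r, m) \<le> T (r, Suc m)"
    using T \<open>r < n\<close> by (auto simp: ssyt_def cells_def)
  with step show ?case by simp
qed simp

lemma ssyt_col_less:
  assumes "T \<in> ssyt n lam" "is_partition n lam" "Suc r < n" "j < lam (Suc r)"
  shows "T (r, j) < T (Suc r, j)"
proof -
  have "lam (Suc r) \<le> lam r"
    using assms(2) by (simp add: is_partition_def)
  then show ?thesis
    using assms by (auto simp: ssyt_def cells_def)
qed

lemma ssyt_row_le:
  assumes T: "T \<in> ssyt n lam" and lam: "is_partition n lam"
  shows "r < n \<Longrightarrow> j < lam r \<Longrightarrow> r \<le> T (r, j)"
proof (induction r)
  case (Suc r)
  moreover have "lam (Suc r) \<le> lam r"
    using lam by (simp add: is_partition_def)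
  ultimately show ?case
    using ssyt_col_less[OF T lam, of r j] by auto
qed simp

text \<open>
  In a row of a semistandard tableau the entries below \<open>m\<close> form an initial segment. This is its
  length, as the position of the first other entry.
\<close>

definition shape_below :: "nat \<Rightarrow> (nat \<Rightarrow> nat) \<Rightarrow> (nat \<times> nat \<Rightarrow> nat) \<Rightarrow> nat \<Rightarrow> nat" where
  "shape_below m lam T r = (LEAST j. j = lam r \<or> m \<le> T (r, j))"

lemma less_shape_below_iff:
  assumes mono: "\<And>j j'. j \<le> j' \<Longrightarrow> j' < lam r \<Longrightarrow> T (r, j) \<le> T (r, j')"
  shows "j < shape_below m lam T r \<longleftrightarrow> j < lam r \<and> T (r, j) < m"
proof -
  let ?P = "\<lambda>j. j = lam r \<or> m \<le> T (r, j)"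
  have 1: "?P (shape_below m lam T r)"
    unfolding shape_below_def by (rule LeastI[of ?P "lam r"]) simp
  have 2: "shape_below m lam T r \<le> lam r"
    unfolding shape_below_def by (rule Least_le) simp
  have 3: "\<not> ?P j" if "j < shape_below m lam T r" for j
    using that unfolding shape_below_def by (rule not_less_Least)
  show ?thesis
    using 1 2 3[of j] mono[of "shape_below m lam T r" j] by force
qed

text \<open>
  The largest letter \<open>n\<close> of a tableau occupies a horizontal strip, as a column contains it at most
  once and only at its end. Removing these cells is a bijection, inverted by filling the strip with
  \<open>n\<close> again. The remaining shape has at most \<open>n\<close> rows because an entry of row \<open>r\<close> is at least \<open>r\<close>.
\<close>

lemma schur_Suc:
  assumes lam: "is_partition (Suc n) lam"
  shows "schur (Suc n) lam =
    (\<Sum>kap\<in>strips_down n lam. schur n kap * X n ^ (psize (Suc n) lam - psize n kap))"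
proof -
  let ?down = "\<lambda>T. (shape_below n lam T, restrict T (cells n (shape_below n lam T)))"
  let ?up = "\<lambda>(kap, T) c. if c \<in> cells (Suc n) lam then if c \<in> cells n kap then T c else n
    else undefined"
  have below: "j < shape_below n lam T r \<longleftrightarrow> j < lam r \<and> T (r, j) < n"
    if T: "T \<in> ssyt (Suc n) lam" for T r j
  proof (cases "r < Suc n")
    case True
    show ?thesis
      by (rule less_shape_below_iff) (rule ssyt_row_mono[OF T True])
  next
    case False
    then have "lam r = 0" using lam by (simp add: is_partition_def)
    then show ?thesis by (subst less_shape_below_iff) auto
  qed
  have sub: "cells n kap \<subseteq> cells (Suc n) lam" if "kap \<in> strips_down n lam" for kap
    using that by (force simp: strips_down_def hstrip_def cells_def intro: less_le_trans)
  have down_strip: "shape_below n lam T \<in> strips_down n lam" if T: "T \<in> ssyt (Suc n) lam" for T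
  proof -
    have "shape_below n lam T r \<le> lam r" for r
      using below[OF T, of "lam r" r] by simp
    moreover have "lam (Suc r) \<le> shape_below n lam T r" for r
    proof (cases "Suc r < Suc n")
      case True
      have "j < shape_below n lam T r" if j: "j < lam (Suc r)" for j
      proof -
        have "T (Suc r, j) < Suc n"
          using T True j by (auto simp: ssyt_def cells_def)
        moreover have "lam (Suc r) \<le> lam r"
          using lam by (simp add: is_partition_def)
        ultimately show ?thesis
          using below[OF T] ssyt_col_less[OF T lam True j] j by auto
      qed
      then show ?thesis by (meson not_le less_irrefl)
    next
      case False
      then show ?thesis using lam by (simp add: is_partition_def)
    qed
    moreover have "shape_below n lam T r = 0" if "n \<le> r" for r
    proof (rule ccontr)
      assume "shape_below n lam T r \<noteq> 0"
      then have "0 < lam r" "T (r, 0) < n"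
        using below[OF T, of 0 r] by auto
      moreover then have "r < Suc n"
        using lam by (auto simp: is_partition_def not_less_eq[symmetric] intro: ccontr)
      ultimately show False
        using ssyt_row_le[OF T lam, of r 0] that by simp
    qed
    ultimately show ?thesis by (simp add: strips_down_def hstrip_def)
  qed
  have down_ssyt: "restrict T (cells n (shape_below n lam T)) \<in> ssyt n (shape_below n lam T)"
    if T: "T \<in> ssyt (Suc n) lam" for T
  proof -
    have adj: "(\<forall>i j. (i, j) \<in> cells (Suc n) lam \<longrightarrow> (i, Suc j) \<in> cells (Suc n) lam \<longrightarrow> T (i, j) \<le> T (i, Suc j))"
      "(\<forall>i j. (i, j) \<in> cells (Suc n) lam \<longrightarrow> (Suc i, j) \<in> cells (Suc n) lam \<longrightarrow> T (i, j) < T (Suc i, j))"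
      using T by (auto simp: ssyt_def)
    have "T (i, j) < n" if "(i, j) \<in> cells n (shape_below n lam T)" for i j
      using that below[OF T] by (auto simp: cells_def)
    then show ?thesis
      using adj sub[OF down_strip[OF T]] by (auto simp: ssyt_def subset_iff)
  qed
  have up_ssyt: "?up (kap, T) \<in> ssyt (Suc n) lam"
    if kap: "kap \<in> strips_down n lam" and T: "T \<in> ssyt n kap" for kap T
  proof -
    have Tn: "T c < n" if "c \<in> cells n kap" for c
      using T that by (auto simp: ssyt_def)
    have row: "T (i, j) \<le> T (i, Suc j)" if "(i, Suc j) \<in> cells n kap" for i j
      using T that by (auto simp: ssyt_def cells_def)
    have col: "T (i, j) < T (Suc i, j)" if "(i, j) \<in> cells n kap" "(Suc i, j) \<in> cells n kap" for i j
      using T that by (auto simp: ssyt_def)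
    have left: "(i, j) \<in> cells n kap" if "(i, Suc j) \<in> cells n kap" for i j
      using that by (auto simp: cells_def)
    have above: "(i, j) \<in> cells n kap" if "(Suc i, j) \<in> cells (Suc n) lam" for i j
    proof -
      have "lam (Suc i) \<le> kap i"
        using kap by (simp add: strips_down_def hstrip_def)
      then show ?thesis using that by (auto simp: cells_def)
    qed
    show ?thesis
      unfolding ssyt_def
    proof (intro CollectI conjI allI impI)
      show "?up (kap, T) \<in> cells (Suc n) lam \<rightarrow>\<^sub>E {..<Suc n}"
        using Tn by (auto simp: PiE_iff extensional_def intro: less_SucI)
    next
      fix i j assume "(i, j) \<in> cells (Suc n) lam" "(i, Suc j) \<in> cells (Suc n) lam"
      then show "?up (kap, T) (i, j) \<le> ?up (kap, T) (i, Suc j)"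
        using row left Tn by (auto intro: less_imp_le)
    next
      fix i j assume "(i, j) \<in> cells (Suc n) lam" "(Suc i, j) \<in> cells (Suc n) lam"
      then show "?up (kap, T) (i, j) < ?up (kap, T) (Suc i, j)"
        using col above Tn by auto
    qed
  qed
  have "schur (Suc n) lam = (\<Sum>(kap, T)\<in>Sigma (strips_down n lam) (ssyt n).
      (\<Prod>c\<in>cells n kap. X (T c)) * X n ^ (psize (Suc n) lam - psize n kap))"
    unfolding schur_def
  proof (rule sum.reindex_bij_witness[where j = ?down and i = ?up])
    fix T assume T: "T \<in> ssyt (Suc n) lam"
    have ext: "T c = undefined" if "c \<notin> cells (Suc n) lam" for c
      using T that by (auto simp: ssyt_def)
    have "T c = n" if "c \<in> cells (Suc n) lam" "c \<notin> cells n (shape_below n lam T)" for c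
    proof -
      obtain r j where c: "c = (r, j)" by force
      have "T c \<le> n" using T that by (auto simp: ssyt_def less_Suc_eq_le)
      moreover have "r \<le> T c"
        using ssyt_row_le[OF T lam] that c by (auto simp: cells_def)
      ultimately show ?thesis
        using that below[OF T, of j r] c by (auto simp: cells_def)
    qed
    then show "?up (?down T) = T"
      using ext by (auto simp: fun_eq_iff)
    show "?down T \<in> Sigma (strips_down n lam) (ssyt n)"
      using down_strip[OF T] down_ssyt[OF T] by simp
    let ?k = "shape_below n lam T"
    have "(\<Prod>c\<in>cells (Suc n) lam. X (T c)) =
        (\<Prod>c\<in>cells (Suc n) lam - cells n ?k. X (T c)) * (\<Prod>c\<in>cells n ?k. X (T c))"
      by (rule prod.subset_diff[OF sub[OF down_strip[OF T]] finite_cells])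
    also have "(\<Prod>c\<in>cells (Suc n) lam - cells n ?k. X (T c)) =
        (\<Prod>c\<in>cells (Suc n) lam - cells n ?k. X n)"
      using \<open>\<And>c. c \<in> cells (Suc n) lam \<Longrightarrow> c \<notin> cells n ?k \<Longrightarrow> T c = n\<close>
      by (intro prod.cong) auto
    also have "\<dots> = X n ^ (psize (Suc n) lam - psize n ?k)"
      using sub[OF down_strip[OF T]] by (simp add: card_Diff_subset finite_cells card_cells)
    finally show "(case ?down T of (kap, T) \<Rightarrow> (\<Prod>c\<in>cells n kap. X (T c)) *
        X n ^ (psize (Suc n) lam - psize n kap)) = (\<Prod>c\<in>cells (Suc n) lam. X (T c))"
      by (simp add: mult.commute)
  next
    fix p assume p: "p \<in> Sigma (strips_down n lam) (ssyt n)"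
    then obtain kap T where pk: "p = (kap, T)" and kap: "kap \<in> strips_down n lam"
      and T: "T \<in> ssyt n kap" by auto
    note U = up_ssyt[OF kap T]
    show "?up p \<in> ssyt (Suc n) lam" using U pk by simp
    have iff: "j < shape_below n lam (?up p) r \<longleftrightarrow> j < kap r" for r j
    proof -
      have Tn: "T c < n" if "c \<in> cells n kap" for c
        using T that by (auto simp: ssyt_def)
      have "j < shape_below n lam (?up p) r \<longleftrightarrow> j < lam r \<and> ?up p (r, j) < n"
        using below[OF U] pk by simp
      also have "\<dots> \<longleftrightarrow> (r, j) \<in> cells n kap"
      proof (cases "r < Suc n")
        case True
        then show ?thesis
          using Tn[of "(r, j)"] sub[OF kap] by (auto simp: pk cells_def)
      next
        case False
        then show ?thesis using lam by (auto simp: is_partition_def cells_def)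
      qed
      also have "\<dots> \<longleftrightarrow> j < kap r"
        using kap by (force simp: strips_down_def cells_def not_less[symmetric] intro: ccontr)
      finally show ?thesis .
    qed
    have sh: "shape_below n lam (?up p) = kap"
    proof
      fix r
      show "shape_below n lam (?up p) r = kap r"
        using iff[of "kap r" r] iff[of "shape_below n lam (?up p) r" r] by simp
    qed
    have "restrict (?up p) (cells n kap) = T"
      using T sub[OF kap] by (auto simp: pk fun_eq_iff ssyt_def PiE_iff extensional_def)
    with sh show "?down (?up p) = p" by (simp add: pk)
  qed
  also have "\<dots> = (\<Sum>kap\<in>strips_down n lam. schur n kap * X n ^ (psize (Suc n) lam - psize n kap))"
    by (simp add: sum.Sigma[symmetric] finite_strips_down finite_ssyt schur_def sum_distrib_right)
  finally show ?thesis .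
qed

lemma complete_h_Suc:
  "complete_h (Suc n) (int r) = (\<Sum>a\<le>r. X n ^ a * complete_h n (int (r - a)))"
proof -
  let ?S = "\<lambda>n r. {a \<in> {..<n::nat} \<rightarrow>\<^sub>E (UNIV :: nat set). int (\<Sum>i<n. a i) = int r}"
  have "complete_h (Suc n) (int r) = (\<Sum>f\<in>?S (Suc n) r. \<Prod>i<Suc n. X i ^ f i)"
    by (simp only: complete_h_def)
  also have "\<dots> = (\<Sum>(a, g)\<in>(SIGMA a:{..r}. ?S n (r - a)). X n ^ a * (\<Prod>i<n. X i ^ g i))"
  proof (rule sum.reindex_bij_witness[where j = "\<lambda>f. (f n, restrict f {..<n})"
        and i = "\<lambda>(a, g). g(n := a)"])
    fix f assume f: "f \<in> ?S (Suc n) r"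
    show "(case (f n, restrict f {..<n}) of (a, g) \<Rightarrow> g(n := a)) = f"
      using f by (auto simp: fun_eq_iff PiE_iff extensional_def)
    have "(\<Sum>i<n. f i) + f n = r"
      using f by (simp del: of_nat_sum)
    then show "(f n, restrict f {..<n}) \<in> (SIGMA a:{..r}. ?S n (r - a))"
      by (auto simp del: of_nat_sum)
    show "(case (f n, restrict f {..<n}) of (a, g) \<Rightarrow> X n ^ a * (\<Prod>i<n. X i ^ g i)) =
        (\<Prod>i<Suc n. X i ^ f i)"
      by (simp add: mult.commute)
  next
    fix p assume "p \<in> (SIGMA a:{..r}. ?S n (r - a))"
    then obtain a g where p: "p = (a, g)" and a: "a \<le> r" and g: "g \<in> ?S n (r - a)" by auto
    show "((case p of (a, g) \<Rightarrow> g(n := a)) n, restrict (case p of (a, g) \<Rightarrow> g(n := a)) {..<n}) = p"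
      using g by (auto simp: p fun_eq_iff PiE_iff extensional_def)
    have "(\<Sum>i<Suc n. (g(n := a)) i) = r"
      using g a by (simp del: of_nat_sum)
    moreover have "g(n := a) \<in> {..<Suc n} \<rightarrow>\<^sub>E UNIV"
      using g by (auto simp: PiE_iff extensional_def)
    ultimately show "(case p of (a, g) \<Rightarrow> g(n := a)) \<in> ?S (Suc n) r"
      by (simp add: p del: of_nat_sum)
  qed
  also have "\<dots> = (\<Sum>a\<le>r. X n ^ a * complete_h n (int (r - a)))"
    unfolding complete_h_def sum_distrib_left
    by (rule sum.Sigma[symmetric], rule finite_atMost, intro ballI, rule finite_exponents)
  finally show ?thesis .
qed

section \<open>The Pieri rule\<close>

text \<open>
  If two partitions \<open>lam\<close> and \<open>kap\<close> both extend \<open>sig\<close> by a horizontal strip, then part \<open>i\<close> of \<open>sig\<close>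
  ranges over the interval from \<open>max (lam (Suc i)) (kap (Suc i))\<close> to \<open>min (lam i) (kap i)\<close>. If
  both are contained in \<open>rho\<close> with horizontal strips as complements, then part \<open>i + 1\<close> of \<open>rho\<close> ranges
  over the very same interval, while part \<open>0\<close> is only bounded below. Reflecting every interval
  therefore exchanges the common lower neighbours \<open>sig\<close> with the upper ones \<open>rho\<close>, up to the
  free choice of \<open>rho 0\<close>.
\<close>

lemma psize_mono: "hstrip kap lam \<Longrightarrow> psize n kap \<le> psize n lam"
  by (auto simp: psize_def hstrip_def intro: sum_mono)

definition swap_side :: "(nat \<Rightarrow> nat) \<Rightarrow> (nat \<Rightarrow> nat) \<Rightarrow> (nat \<Rightarrow> nat) \<Rightarrow> nat \<Rightarrow> nat" where
  "swap_side lam kap rho i =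
     max (lam (Suc i)) (kap (Suc i)) + min (lam i) (kap i) - rho i"

definition above_both :: "(nat \<Rightarrow> nat) \<Rightarrow> (nat \<Rightarrow> nat) \<Rightarrow> nat \<Rightarrow> (nat \<Rightarrow> nat) \<Rightarrow> nat \<Rightarrow> nat" where
  "above_both lam kap a sig i = (case i of 0 \<Rightarrow> a + max (lam 0) (kap 0) | Suc i' \<Rightarrow> swap_side lam kap sig i')"

lemma swap_side_bounds:
  assumes "max (lam (Suc i)) (kap (Suc i)) \<le> rho i" "rho i \<le> min (lam i) (kap i)"
  shows "max (lam (Suc i)) (kap (Suc i)) \<le> swap_side lam kap rho i"
    and "swap_side lam kap rho i \<le> min (lam i) (kap i)"
    and "swap_side lam kap rho i + rho i = max (lam (Suc i)) (kap (Suc i)) + min (lam i) (kap i)"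
  using assms unfolding swap_side_def by linarith+

lemma sum_max_min_rows:
  assumes "kap n = (0 :: nat)"
  shows "max (lam 0) (kap 0) + (\<Sum>i<n. max (lam (Suc i)) (kap (Suc i)) + min (lam i) (kap i)) =
    psize (Suc n) lam + psize n kap"
proof -
  have "max (lam 0) (kap 0) + (\<Sum>i<n. max (lam (Suc i)) (kap (Suc i)) + min (lam i) (kap i)) =
      (\<Sum>i<Suc n. max (lam i) (kap i)) + (\<Sum>i<n. min (lam i) (kap i))"
    by (subst sum.lessThan_Suc_shift) (simp add: sum.distrib)
  also have "\<dots> = (\<Sum>i<Suc n. max (lam i) (kap i) + min (lam i) (kap i))"
    using assms by (simp add: sum.distrib)
  also have "\<dots> = (\<Sum>i<Suc n. lam i + kap i)"
    by (rule sum.cong) auto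
  also have "\<dots> = psize (Suc n) lam + psize n kap"
    using assms by (simp add: sum.distrib psize_def)
  finally show ?thesis .
qed

text \<open>
  For fixed \<open>kap\<close>, the reflection of intervals turns an upper neighbour \<open>rho\<close> of \<open>lam\<close> and \<open>kap\<close> into
  a lower neighbour \<open>sig\<close> together with the excess \<open>a\<close> of \<open>rho 0\<close> over its lower bound. Summing the
  interval bounds shows \<open>|rho| + |sig| = a + |lam| + |kap|\<close>, so that the statistic \<open>|rho| - |kap|\<close>
  becomes \<open>a + |lam| - |sig|\<close>. In generating function terms: adding a strip and then
  removing one equals removing one and then adding one, times \<open>1 / (1 - x t)\<close>; the factor accounts
  for \<open>a\<close>.
\<close>

lemma strips_exchange:
  fixes g :: "nat \<Rightarrow> (nat \<Rightarrow> nat) \<Rightarrow> 'a::comm_monoid_add"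
  assumes lam: "is_partition (Suc n) lam"
  shows "(\<Sum>(rho, kap)\<in>Sigma (strips_up (Suc n) lam (int r)) (strips_down n).
      g (psize (Suc n) rho - psize n kap) kap) =
    (\<Sum>(a, sig, kap)\<in>(SIGMA a:{..r}. SIGMA sig:strips_down n lam. strips_up n sig (int (r - a))).
      g (a + (psize (Suc n) lam - psize n sig)) kap)"
proof (rule sum.reindex_bij_witness[where
      j = "\<lambda>(rho, kap). (rho 0 - max (lam 0) (kap 0), swap_side lam kap (\<lambda>i. rho (Suc i)), kap)" and
      i = "\<lambda>(a, sig, kap). (above_both lam kap a sig, kap)"])
  fix p assume "p \<in> Sigma (strips_up (Suc n) lam (int r)) (strips_down n)"
  then obtain rho kap where p: "p = (rho, kap)" and rho: "rho \<in> strips_up (Suc n) lam (int r)"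
    and kap: "kap \<in> strips_down n rho" by auto
  let ?a = "rho 0 - max (lam 0) (kap 0)"
  let ?sig = "swap_side lam kap (\<lambda>i. rho (Suc i))"
  have h: "hstrip lam rho" "hstrip kap rho"
    and zero: "\<And>i. i \<ge> n \<Longrightarrow> kap i = 0" "\<And>i. i \<ge> Suc n \<Longrightarrow> lam i = 0" "\<And>i. i \<ge> Suc n \<Longrightarrow> rho i = 0"
    and size: "psize (Suc n) rho = psize (Suc n) lam + r"
    using rho kap lam by (auto simp: strips_up_def strips_down_def is_partition_def)
  have "max (lam (Suc i)) (kap (Suc i)) \<le> rho (Suc i)" "rho (Suc i) \<le> min (lam i) (kap i)" for i
    using h by (simp_all add: hstrip_def)
  note sb = swap_side_bounds[of lam _ kap "\<lambda>i. rho (Suc i)", OF this]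
  have top: "max (lam 0) (kap 0) \<le> rho 0"
    using h by (simp add: hstrip_def)
  have sig_lam: "hstrip ?sig lam" and sig_kap: "hstrip ?sig kap"
    using sb(1,2) by (simp_all add: hstrip_def)
  have sig_zero: "?sig i = 0" if "i \<ge> n" for i
    using sb(2)[of i] zero(1)[OF that] by simp
  have "(\<Sum>i<n. ?sig i + rho (Suc i)) =
      (\<Sum>i<n. max (lam (Suc i)) (kap (Suc i)) + min (lam i) (kap i))"
    using sb(3) by simp
  then have "psize n ?sig + psize (Suc n) rho =
      ?a + (max (lam 0) (kap 0) + (\<Sum>i<n. max (lam (Suc i)) (kap (Suc i)) + min (lam i) (kap i)))"
    using top by (simp add: psize_def sum.distrib sum.lessThan_Suc_shift del: sum.lessThan_Suc)
  then have tot: "psize n ?sig + psize (Suc n) rho = ?a + psize (Suc n) lam + psize n kap"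
    using sum_max_min_rows[of kap n lam] zero(1)[of n] by simp
  have le: "psize n ?sig \<le> psize n kap" "psize n ?sig \<le> psize (Suc n) lam"
    using psize_mono[OF sig_kap] psize_mono[OF sig_lam, of n]
    by (auto simp: psize_def)
  have "?a \<le> r" using tot le size by linarith
  moreover have "?sig \<in> strips_down n lam"
    using sig_lam sig_zero by (simp add: strips_down_def)
  moreover have "kap \<in> strips_up n ?sig (int (r - ?a))"
    using sig_kap zero tot size le \<open>?a \<le> r\<close> by (simp add: strips_up_def)
  ultimately show "(case p of (rho, kap) \<Rightarrow>
      (rho 0 - max (lam 0) (kap 0), swap_side lam kap (\<lambda>i. rho (Suc i)), kap)) \<in>
      (SIGMA a:{..r}. SIGMA sig:strips_down n lam. strips_up n sig (int (r - a)))"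
    by (simp add: p)
  have "above_both lam kap ?a ?sig = rho"
  proof
    fix i
    show "above_both lam kap ?a ?sig i = rho i"
    proof (cases i)
      case 0
      then show ?thesis using top by (simp add: above_both_def)
    next
      case (Suc i')
      then show ?thesis
        using sb(3)[of i'] by (simp add: above_both_def swap_side_def[of lam kap ?sig])
    qed
  qed
  then show "(case case p of (rho, kap) \<Rightarrow>
      (rho 0 - max (lam 0) (kap 0), swap_side lam kap (\<lambda>i. rho (Suc i)), kap) of
      (a, sig, kap) \<Rightarrow> (above_both lam kap a sig, kap)) = p"
    by (simp add: p)
  have "psize (Suc n) rho - psize n kap = ?a + (psize (Suc n) lam - psize n ?sig)"
    using tot le by linarith
  then show "(case case p of (rho, kap) \<Rightarrow>
      (rho 0 - max (lam 0) (kap 0), swap_side lam kap (\<lambda>i. rho (Suc i)), kap) of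
      (a, sig, kap) \<Rightarrow> g (a + (psize (Suc n) lam - psize n sig)) kap) =
      (case p of (rho, kap) \<Rightarrow> g (psize (Suc n) rho - psize n kap) kap)"
    by (simp add: p)
next
  fix p assume "p \<in> (SIGMA a:{..r}. SIGMA sig:strips_down n lam. strips_up n sig (int (r - a)))"
  then obtain a sig kap where p: "p = (a, sig, kap)" and a: "a \<le> r"
    and sig: "sig \<in> strips_down n lam" and kap: "kap \<in> strips_up n sig (int (r - a))" by auto
  let ?rho = "above_both lam kap a sig"
  have h: "hstrip sig lam" "hstrip sig kap"
    and zero: "\<And>i. i \<ge> n \<Longrightarrow> kap i = 0" "\<And>i. i \<ge> Suc n \<Longrightarrow> lam i = 0" "\<And>i. i \<ge> n \<Longrightarrow> sig i = 0"
    and size: "psize n kap = psize n sig + (r - a)"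
    using sig kap lam by (auto simp: strips_up_def strips_down_def is_partition_def)
  have "max (lam (Suc i)) (kap (Suc i)) \<le> sig i" "sig i \<le> min (lam i) (kap i)" for i
    using h by (simp_all add: hstrip_def)
  note sb = swap_side_bounds[of lam _ kap sig, OF this]
  have rho0: "?rho 0 = a + max (lam 0) (kap 0)"
    and rhoS: "\<And>i. ?rho (Suc i) = swap_side lam kap sig i"
    by (simp_all add: above_both_def)
  have ge: "lam i \<le> ?rho i" "kap i \<le> ?rho i" for i
    using sb(1) by (cases i; simp add: rho0 rhoS)+
  have rho_lam: "hstrip lam ?rho" and rho_kap: "hstrip kap ?rho"
    using sb(2) ge by (simp_all add: hstrip_def rhoS)
  have rho_zero: "?rho i = 0" if "i \<ge> Suc n" for i
    using that sb(2)[of "i - 1"] zero(1)[of "i - 1"] rhoS[of "i - 1"] by simp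
  have "(\<Sum>i<n. swap_side lam kap sig i + sig i) =
      (\<Sum>i<n. max (lam (Suc i)) (kap (Suc i)) + min (lam i) (kap i))"
    using sb(3) by simp
  then have "psize n sig + psize (Suc n) ?rho =
      a + (max (lam 0) (kap 0) + (\<Sum>i<n. max (lam (Suc i)) (kap (Suc i)) + min (lam i) (kap i)))"
    by (simp add: psize_def sum.distrib sum.lessThan_Suc_shift rho0 rhoS del: sum.lessThan_Suc)
  then have "psize n sig + psize (Suc n) ?rho = a + psize (Suc n) lam + psize n kap"
    using sum_max_min_rows[of kap n lam] zero(1)[of n] by simp
  then have "psize (Suc n) ?rho = psize (Suc n) lam + r"
    using size a by linarith
  then have "?rho \<in> strips_up (Suc n) lam (int r)"
    using rho_lam rho_zero by (simp add: strips_up_def)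
  moreover have "kap \<in> strips_down n ?rho"
    using rho_kap zero by (simp add: strips_down_def)
  ultimately show "(case p of (a, sig, kap) \<Rightarrow> (above_both lam kap a sig, kap)) \<in>
      Sigma (strips_up (Suc n) lam (int r)) (strips_down n)"
    by (simp add: p)
  have "swap_side lam kap (\<lambda>i. ?rho (Suc i)) = sig"
  proof
    fix i
    show "swap_side lam kap (\<lambda>i. ?rho (Suc i)) i = sig i"
      using sb(3)[of i] by (simp add: rhoS swap_side_def[of lam kap "swap_side lam kap sig"])
  qed
  then show "(case case p of (a, sig, kap) \<Rightarrow> (above_both lam kap a sig, kap) of
      (rho, kap) \<Rightarrow>
      (rho 0 - max (lam 0) (kap 0), swap_side lam kap (\<lambda>i. rho (Suc i)), kap)) = p"
    by (simp add: p rho0)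
qed

lemma schur_0: "schur 0 lam = 1"
  by (simp add: schur_def ssyt_def cells_def)

lemma complete_h_no_variables: "complete_h 0 r = (if r = 0 then 1 else 0)"
  by (auto simp: complete_h_def)

text \<open>
  The branching rule in the last variable is applied on both sides. Exchanging the added strip with
  the removed one leaves Pieri products \<open>h\<^bsub>r-a\<^esub> s\<^bsub>sig\<^esub>\<close> in one variable less, and the factors
  \<open>X n ^ a\<close> of the exchange assemble the \<open>h\<^bsub>r-a\<^esub>\<close> in \<open>n\<close> variables to \<open>h\<^sub>r\<close> in \<open>n + 1\<close> variables.
\<close>

theorem pieri:
  "is_partition n lam \<Longrightarrow> complete_h n r * schur n lam = (\<Sum>rho\<in>strips_up n lam r. schur n rho)"
proof (induction n arbitrary: lam r)
  case 0
  then have "strips_up 0 lam r = (if r = 0 then {\<lambda>_. 0} else {})"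
    by (auto simp: strips_up_def is_partition_def hstrip_def psize_def fun_eq_iff)
  then show ?case
    by (simp add: schur_0 complete_h_no_variables)
next
  case (Suc n)
  show ?case
  proof (cases "r < 0")
    case True
    then have "strips_up (Suc n) lam r = {}"
      using psize_mono[of lam _ "Suc n"] by (fastforce simp: strips_up_def)
    then show ?thesis
      using True by (simp add: complete_h_neg)
  next
    case False
    then obtain r' where r: "r = int r'"
      by (metis not_less zero_le_imp_eq_int)
    have "complete_h (Suc n) r * schur (Suc n) lam =
      (\<Sum>a\<le>r'. \<Sum>sig\<in>strips_down n lam.
        X n ^ a * complete_h n (int (r' - a)) * (schur n sig * X n ^ (psize (Suc n) lam - psize n sig)))"
      unfolding r complete_h_Suc schur_Suc[OF Suc.prems] by (rule sum_product)
    also have "\<dots> = (\<Sum>a\<le>r'. \<Sum>sig\<in>strips_down n lam. \<Sum>kap\<in>strips_up n sig (int (r' - a)).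
        schur n kap * X n ^ (a + (psize (Suc n) lam - psize n sig)))"
    proof (intro sum.cong refl)
      fix a sig assume "sig \<in> strips_down n lam"
      then have "complete_h n (int (r' - a)) * schur n sig = (\<Sum>kap\<in>strips_up n sig (int (r' - a)). schur n kap)"
        by (rule Suc.IH[OF strips_down_partition])
      then show "X n ^ a * complete_h n (int (r' - a)) * (schur n sig * X n ^ (psize (Suc n) lam - psize n sig)) =
        (\<Sum>kap\<in>strips_up n sig (int (r' - a)). schur n kap * X n ^ (a + (psize (Suc n) lam - psize n sig)))"
        by (simp add: sum_distrib_right[symmetric] power_add mult_ac)
    qed
    also have "\<dots> = (\<Sum>(a, sig, kap)\<in>(SIGMA a:{..r'}. SIGMA sig:strips_down n lam. strips_up n sig (int (r' - a))).
        schur n kap * X n ^ (a + (psize (Suc n) lam - psize n sig)))"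
      by (simp add: sum.Sigma finite_strips_down finite_strips_up del: of_nat_diff)
    also have "\<dots> = (\<Sum>(rho, kap)\<in>Sigma (strips_up (Suc n) lam r) (strips_down n).
        schur n kap * X n ^ (psize (Suc n) rho - psize n kap))"
      unfolding r
      by (rule strips_exchange[OF Suc.prems, of "\<lambda>e kap. schur n kap * X n ^ e", symmetric])
    also have "\<dots> = (\<Sum>rho\<in>strips_up (Suc n) lam r. schur (Suc n) rho)"
      by (simp add: sum.Sigma[symmetric] finite_strips_down finite_strips_up
          schur_Suc[OF strips_up_partition] cong: sum.cong)
    finally show ?thesis .
  qed
qed

section \<open>Products of complete homogeneous polynomials\<close>

text \<open>
  These are the tableaux of content \<open>tau\<close> with entries below \<open>m\<close> and at most \<open>n\<close> rows. The members beyond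
  index \<open>m\<close> carry no information; setting them to zero makes a chain determined by its first \<open>m + 1\<close>
  members.
\<close>

definition strip_chains ::
  "nat \<Rightarrow> nat \<Rightarrow> (nat \<Rightarrow> int) \<Rightarrow> (nat \<Rightarrow> nat \<Rightarrow> nat) set" where
  "strip_chains n m tau = {P. P 0 = (\<lambda>_. 0) \<and> (\<forall>i<m. P (Suc i) \<in> strips_up n (P i) (tau i)) \<and>
     (\<forall>i>m. P i = (\<lambda>_. 0))}"

lemma strip_chains_partition:
  assumes "P \<in> strip_chains n m tau"
  shows "is_partition n (P i)"
proof (cases i)
  case 0
  then show ?thesis using assms by (simp add: strip_chains_def is_partition_def)
next
  case (Suc i')
  show ?thesis
  proof (cases "i' < m")
    case True
    then have "P (Suc i') \<in> strips_up n (P i') (tau i')"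
      using assms by (simp add: strip_chains_def)
    with Suc show ?thesis using strips_up_partition by simp
  next
    case False
    then show ?thesis using assms Suc by (simp add: strip_chains_def is_partition_def)
  qed
qed

lemma strip_chains_Suc:
  "strip_chains n (Suc m) tau = (\<lambda>(P, rho). P(Suc m := rho)) `
     (SIGMA P:strip_chains n m tau. strips_up n (P m) (tau m))"
proof (intro equalityI subsetI)
  fix P assume P: "P \<in> strip_chains n (Suc m) tau"
  show "P \<in> (\<lambda>(P, rho). P(Suc m := rho)) `
     (SIGMA P:strip_chains n m tau. strips_up n (P m) (tau m))"
  proof (rule image_eqI)
    show "P = (\<lambda>(P, rho). P(Suc m := rho)) (P(Suc m := (\<lambda>_. 0)), P (Suc m))"
      by simp
    show "(P(Suc m := (\<lambda>_. 0)), P (Suc m)) \<in> (SIGMA P:strip_chains n m tau. strips_up n (P m) (tau m))"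
      using P by (auto simp: strip_chains_def)
  qed
next
  fix P assume "P \<in> (\<lambda>(P, rho). P(Suc m := rho)) `
     (SIGMA P:strip_chains n m tau. strips_up n (P m) (tau m))"
  then show "P \<in> strip_chains n (Suc m) tau"
    by (auto simp: strip_chains_def less_Suc_eq)
qed

lemma inj_on_extend_chain:
  "inj_on (\<lambda>(P, rho). P(Suc m := rho)) (SIGMA P:strip_chains n m tau. strips_up n (P m) (tau m))"
proof (rule inj_onI, clarify, rule conjI)
  fix P rho P' rho'
  assume P: "P \<in> strip_chains n m tau" "P' \<in> strip_chains n m tau"
    and eq: "P(Suc m := rho) = P'(Suc m := rho')"
  show "rho = rho'"
    using fun_cong[OF eq, of "Suc m"] by simp
  have "P i = P' i" for i
    using fun_cong[OF eq, of i] P by (cases "i = Suc m") (auto simp: strip_chains_def)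
  then show "P = P'" by blast
qed

lemma finite_strip_chains: "finite (strip_chains n m tau)"
proof (induction m)
  case 0
  have "strip_chains n 0 tau \<subseteq> {\<lambda>_ _. 0}"
    by (auto simp: strip_chains_def fun_eq_iff) (metis neq0_conv)
  then show ?case by (rule finite_subset) simp
next
  case (Suc m)
  then show ?case by (simp add: strip_chains_Suc finite_strips_up)
qed

lemma prod_complete_h_eq_sum_chains:
  "(\<Prod>i<m. complete_h n (tau i)) = (\<Sum>P\<in>strip_chains n m tau. schur n (P m))"
proof (induction m)
  case 0
  have "strip_chains n 0 tau = {\<lambda>_ _. 0}"
    by (auto simp: strip_chains_def fun_eq_iff) (metis neq0_conv)
  moreover have "schur n (\<lambda>_. 0) = 1"
    by (simp add: schur_def ssyt_def cells_def)
  ultimately show ?case by simp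
next
  case (Suc m)
  have "(\<Prod>i<Suc m. complete_h n (tau i)) =
      (\<Sum>P\<in>strip_chains n m tau. complete_h n (tau m) * schur n (P m))"
    by (simp add: Suc sum_distrib_left mult.commute)
  also have "\<dots> = (\<Sum>P\<in>strip_chains n m tau. \<Sum>rho\<in>strips_up n (P m) (tau m). schur n rho)"
    by (intro sum.cong refl pieri strip_chains_partition)
  also have "\<dots> = (\<Sum>(P, rho)\<in>(SIGMA P:strip_chains n m tau. strips_up n (P m) (tau m)). schur n rho)"
    by (simp add: sum.Sigma finite_strip_chains finite_strips_up)
  also have "\<dots> = (\<Sum>P\<in>strip_chains n (Suc m) tau. schur n (P (Suc m)))"
    unfolding strip_chains_Suc
    by (subst sum.reindex[OF inj_on_extend_chain]) (auto intro!: sum.cong)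
  finally show ?case .
qed

section \<open>The Bender-Knuth involution to the right of a column\<close>

text \<open>
  When a chain passes from \<open>a\<close> through a middle partition to \<open>c\<close>, part \<open>r\<close> of the middle one ranges
  between \<open>max (a r) (c (Suc r))\<close> and this value.
\<close>

definition upper_limit :: "(nat \<Rightarrow> nat) \<Rightarrow> (nat \<Rightarrow> nat) \<Rightarrow> nat \<Rightarrow> nat" where
  "upper_limit a c r = (case r of 0 \<Rightarrow> c 0 | Suc r' \<Rightarrow> min (a r') (c r))"

text \<open>
  Reflecting all parts of the middle partition \<open>b\<close> in their intervals is the Bender-Knuth involution,
  which exchanges the numbers of the two letters added by the steps from \<open>a\<close> to \<open>b\<close> and from \<open>b\<close>
  to \<open>c\<close>. Here it acts only on the cells to the right of the first \<open>j\<close> columns: parts that do not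
  reach column \<open>j\<close> stay, and the intervals of the others are cut off at \<open>j\<close> from below.
\<close>

definition toggle ::
  "nat \<Rightarrow> (nat \<Rightarrow> nat) \<Rightarrow> (nat \<Rightarrow> nat) \<Rightarrow> (nat \<Rightarrow> nat) \<Rightarrow> nat \<Rightarrow> nat" where
  "toggle j a b c r =
     (if j \<le> b r then max j (max (a r) (c (Suc r))) + upper_limit a c r - b r else b r)"

lemma strip_limits:
  assumes "hstrip a b" "hstrip b c"
  shows "max (a r) (c (Suc r)) \<le> b r" "b r \<le> upper_limit a c r"
  using assms by (auto simp: hstrip_def upper_limit_def split: nat.split)

lemma hstrip_if_limits:
  assumes "\<And>r. max (a r) (c (Suc r)) \<le> b r" "\<And>r. b r \<le> upper_limit a c r"
  shows "hstrip a b" "hstrip b c"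
proof -
  have "b r \<le> c r" "b (Suc r) \<le> a r" for r
    using assms(2)[of r] assms(2)[of "Suc r"] by (auto simp: upper_limit_def split: nat.splits)
  then show "hstrip a b" "hstrip b c"
    using assms(1) by (auto simp: hstrip_def)
qed

lemma toggle_ge_iff:
  assumes "hstrip a b" "hstrip b c"
  shows "j \<le> toggle j a b c r \<longleftrightarrow> j \<le> b r"
  using strip_limits[OF assms, of r] by (auto simp: toggle_def)

lemma toggle_strips:
  assumes "hstrip a b" "hstrip b c"
  shows "hstrip a (toggle j a b c)" "hstrip (toggle j a b c) c"
proof -
  have "max (a r) (c (Suc r)) \<le> toggle j a b c r" "toggle j a b c r \<le> upper_limit a c r" for r
    using strip_limits[OF assms, of r] unfolding toggle_def by (simp_all split: if_split) linarith+
  then show "hstrip a (toggle j a b c)" "hstrip (toggle j a b c) c"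
    by (rule hstrip_if_limits)+
qed

lemma toggle_toggle:
  assumes "hstrip a b" "hstrip b c"
  shows "toggle j a (toggle j a b c) c = b"
proof
  fix r
  show "toggle j a (toggle j a b c) c r = b r"
    using strip_limits[OF assms, of r] toggle_ge_iff[OF assms, of j r]
    by (cases "j \<le> b r") (simp_all add: toggle_def)
qed

lemma min_toggle:
  assumes "hstrip a b" "hstrip b c" "j' \<le> j"
  shows "min (toggle j a b c r) j' = min (b r) j'"
  using toggle_ge_iff[OF assms(1,2), of j r] assms(3)
  by (cases "j \<le> b r") (simp_all add: toggle_def)

text \<open>
  The lower limit of row \<open>r\<close> and the upper limit of row \<open>r + 1\<close> are the maximum and the minimum of the
  same two numbers \<open>a r\<close> and \<open>c (r + 1)\<close>, so the limits are a rearrangement of the parts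
  of \<open>a\<close> and \<open>c\<close>.
\<close>

lemma sum_limits:
  fixes f :: "nat \<Rightarrow> int"
  assumes "c n = 0"
  shows "(\<Sum>r<n. f (max (a r) (c (Suc r))) + f (upper_limit a c r)) = (\<Sum>r<n. f (a r) + f (c r))"
proof -
  have "(\<Sum>r<m. f (max (a r) (c (Suc r))) + f (upper_limit a c r)) + f (upper_limit a c m) =
      (\<Sum>r<m. f (a r) + f (c r)) + f (c m)" for m
  proof (induction m)
    case (Suc m)
    have "f (max (a m) (c (Suc m))) + f (upper_limit a c (Suc m)) = f (a m) + f (c (Suc m))"
      by (auto simp: upper_limit_def max_def min_def)
    with Suc show ?case by simp
  qed (simp add: upper_limit_def)
  from this[of n] show ?thesis
    using assms by (auto simp: upper_limit_def split: nat.splits)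
qed

text \<open>
  The two sums count the lower and the upper letter in the first \<open>j\<close> columns (each row contributes
  the cells of the strip in these columns). The formula says that the two
  letters exchange their numbers in the remaining columns. The hypothesis says that column \<open>j\<close> does
  not contain the upper letter; otherwise an interval of a row that ends left of column \<open>j\<close> would
  reach \<open>j\<close>, and the untouched part would spoil the count.
\<close>

lemma sum_toggle:
  assumes strips: "hstrip a b" "hstrip b c" and "c n = 0"
    and none: "\<And>r. r < n \<Longrightarrow> j \<le> c r \<Longrightarrow> j \<le> b r"
  shows "int (psize n (toggle j a b c)) + int (psize n b) =
    int (psize n a) + int (psize n c) +
      (\<Sum>r<n. int (min (b r) j) - int (min (a r) j)) - (\<Sum>r<n. int (min (c r) j) - int (min (b r) j))"
proof -
  \<comment> \<open>Beyond column \<open>j\<close>, every row is reflected in its interval cut off at \<open>j\<close>; a row ending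
  before column \<open>j\<close> has the degenerate interval with both ends \<open>j\<close>.\<close>
  have row: "int (toggle j a b c r) + int (b r) = int (max j (max (a r) (c (Suc r)))) +
      int (max j (upper_limit a c r)) - 2 * int j + 2 * int (min (b r) j)" if "r < n" for r
  proof (cases "j \<le> b r")
    case True
    then show ?thesis
      using strip_limits[OF strips, of r] by (simp add: toggle_def)
  next
    case False
    then have "c r < j"
      using none[OF that] by (auto simp: not_le[symmetric])
    moreover have "upper_limit a c r \<le> c r"
      by (auto simp: upper_limit_def split: nat.split)
    ultimately show ?thesis
      using False strip_limits[OF strips, of r] by (simp add: toggle_def)
  qed
  have "int (psize n (toggle j a b c)) + int (psize n b) = (\<Sum>r<n. int (toggle j a b c r) + int (b r))"
    by (simp add: psize_def sum.distrib)
  also have "\<dots> = (\<Sum>r<n. int (max j (max (a r) (c (Suc r)))) + int (max j (upper_limit a c r))) +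
      (\<Sum>r<n. 2 * int (min (b r) j) - 2 * int j)"
    unfolding sum.distrib[symmetric] by (rule sum.cong) (auto simp: row)
  also have "(\<Sum>r<n. int (max j (max (a r) (c (Suc r)))) + int (max j (upper_limit a c r))) =
      (\<Sum>r<n. int (max j (a r)) + int (max j (c r)))"
    by (rule sum_limits[where f = "\<lambda>x. int (max j x)" and c = c and n = n, OF \<open>c n = 0\<close>])
  also have "\<dots> + (\<Sum>r<n. 2 * int (min (b r) j) - 2 * int j) =
      (\<Sum>r<n. int (a r) + int (c r) + (int (min (b r) j) - int (min (a r) j))
        - (int (min (c r) j) - int (min (b r) j)))"
    unfolding sum.distrib[symmetric] by (rule sum.cong) auto
  also have "\<dots> = int (psize n a) + int (psize n c) +
      (\<Sum>r<n. int (min (b r) j) - int (min (a r) j)) - (\<Sum>r<n. int (min (c r) j) - int (min (b r) j))"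
    by (simp add: psize_def sum.distrib sum_subtractf sum_negf sum_distrib_left)
  finally show ?thesis .
qed

section \<open>Leaving the dominant chamber\<close>

text \<open>
  The function \<open>gap\<close> is the difference of the coordinates \<open>i\<close> and \<open>i + 1\<close> of \<open>\<mu> - (content of the
  first j columns)\<close>. The vector \<open>\<delta>\<close> would add \<open>1\<close> to it, so a negative gap means that \<open>\<mu> + \<delta> -
  (content)\<close> is not strictly dominant, and the gap \<open>-1\<close> means that this vector lies on the
  wall \<open>x\<^sub>i = x\<^bsub>i+1\<^esub>\<close>.
\<close>

definition letters_left :: "nat \<Rightarrow> (nat \<Rightarrow> nat \<Rightarrow> nat) \<Rightarrow> nat \<Rightarrow> nat \<Rightarrow> int" where
  "letters_left n P i j = (\<Sum>r<n. int (min (P (Suc i) r) j) - int (min (P i r) j))"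

definition gap :: "nat \<Rightarrow> (nat \<Rightarrow> nat) \<Rightarrow> (nat \<Rightarrow> nat \<Rightarrow> nat) \<Rightarrow> nat \<Rightarrow> nat \<Rightarrow> int" where
  "gap n mu P i j =
     (int (mu i) - letters_left n P i j) - (int (mu (Suc i)) - letters_left n P (Suc i) j)"

definition exits :: "nat \<Rightarrow> (nat \<Rightarrow> nat) \<Rightarrow> (nat \<Rightarrow> nat \<Rightarrow> nat) \<Rightarrow> nat \<Rightarrow> bool" where
  "exits n mu P j \<longleftrightarrow> (\<exists>i. Suc i < n \<and> gap n mu P i j < 0)"

definition exit_col :: "nat \<Rightarrow> (nat \<Rightarrow> nat) \<Rightarrow> (nat \<Rightarrow> nat \<Rightarrow> nat) \<Rightarrow> nat" where
  "exit_col n mu P = (LEAST j. exits n mu P j)"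

definition exit_letter :: "nat \<Rightarrow> (nat \<Rightarrow> nat) \<Rightarrow> (nat \<Rightarrow> nat \<Rightarrow> nat) \<Rightarrow> nat" where
  "exit_letter n mu P = (LEAST i. Suc i < n \<and> gap n mu P i (exit_col n mu P) < 0)"

definition reflect_chain ::
  "nat \<Rightarrow> (nat \<Rightarrow> nat) \<Rightarrow> (nat \<Rightarrow> nat \<Rightarrow> nat) \<Rightarrow> nat \<Rightarrow> nat \<Rightarrow> nat" where
  "reflect_chain n mu P = (let i = exit_letter n mu P in
     P(Suc i := toggle (exit_col n mu P) (P i) (P (Suc i)) (P (Suc (Suc i)))))"

text \<open>
  The set consists of the rows in which column \<open>j + 1\<close> contains the letter \<open>i\<close>.
\<close>

lemma letters_left_Suc:
  assumes "hstrip (P i) (P (Suc i))"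
  shows "letters_left n P i (Suc j) =
    letters_left n P i j + int (card {r. r < n \<and> P i r \<le> j \<and> j < P (Suc i) r})"
proof -
  have "int (min (P (Suc i) r) (Suc j)) - int (min (P i r) (Suc j)) =
      int (min (P (Suc i) r) j) - int (min (P i r) j) + (if P i r \<le> j \<and> j < P (Suc i) r then 1 else 0)"
    for r
    using assms by (auto simp: hstrip_def min_def not_le dest: spec[of _ r])
  then have "letters_left n P i (Suc j) =
      letters_left n P i j + (\<Sum>r<n. if P i r \<le> j \<and> j < P (Suc i) r then 1 else 0)"
    unfolding letters_left_def sum.distrib[symmetric] by (intro sum.cong) auto
  also have "(\<Sum>r<n. if P i r \<le> j \<and> j < P (Suc i) r then 1 else 0) =
      int (card {r. r < n \<and> P i r \<le> j \<and> j < P (Suc i) r})"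
    by (simp add: sum.If_cases Int_def)
  finally show ?thesis .
qed

lemma column_card_le_1:
  assumes "hstrip a b"
  shows "card {r. r < n \<and> a r \<le> j \<and> j < b r} \<le> 1"
proof -
  have "\<not> (a r \<le> j \<and> j < b s)" if "r < s" for r s
  proof -
    have "b s \<le> b (Suc r)"
      using hstrip_antimono(2)[OF assms] that by simp
    also have "\<dots> \<le> a r"
      using assms by (simp add: hstrip_def)
    finally show ?thesis by simp
  qed
  then have "r = s" if "a r \<le> j" "j < b r" "a s \<le> j" "j < b s" for r s
    using that by (metis nat_neq_iff)
  moreover have "finite {r. r < n \<and> a r \<le> j \<and> j < b r}" by simp
  ultimately show ?thesis
    by (auto simp: card_le_Suc0_iff_eq)
qed

lemma strip_chains_hstrip:
  "P \<in> strip_chains n n tau \<Longrightarrow> i < n \<Longrightarrow> hstrip (P i) (P (Suc i))"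
  by (simp add: strip_chains_def strips_up_def)

context
  fixes n :: nat and mu :: "nat \<Rightarrow> nat" and P :: "nat \<Rightarrow> nat \<Rightarrow> nat" and tau :: "nat \<Rightarrow> int"
  assumes mu: "is_partition n mu" and P: "P \<in> strip_chains n n tau"
    and exit: "\<exists>j. exits n mu P j"
begin

abbreviation (input) "xcol \<equiv> exit_col n mu P"
abbreviation (input) "xlet \<equiv> exit_letter n mu P"
abbreviation (input) "toggled \<equiv> toggle xcol (P xlet) (P (Suc xlet)) (P (Suc (Suc xlet)))"

lemma exit_letter_less: "Suc xlet < n"
  and gap_exit_neg: "gap n mu P xlet xcol < 0"
proof -
  have "exits n mu P xcol"
    unfolding exit_col_def using exit by (rule LeastI_ex)
  then have "\<exists>i. Suc i < n \<and> gap n mu P i xcol < 0"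
    by (simp add: exits_def)
  then have "Suc xlet < n \<and> gap n mu P xlet xcol < 0"
    unfolding exit_letter_def by (rule LeastI_ex)
  then show "Suc xlet < n" "gap n mu P xlet xcol < 0" by auto
qed

lemma exit_strips: "hstrip (P xlet) (P (Suc xlet))" "hstrip (P (Suc xlet)) (P (Suc (Suc xlet)))"
  using strip_chains_hstrip[OF P] exit_letter_less by auto

text \<open>
  At the column before the exit the gap is still non-negative, and a column lowers it by at most one:
  it contains each of the letters \<open>i\<close> and \<open>i + 1\<close> at most once. So the exit column must contain \<open>i\<close>,
  not \<open>i + 1\<close>, and the gap is exactly \<open>-1\<close>. The absence of \<open>i + 1\<close> is the hypothesis under which
  toggling to the right of the exit column exchanges the letter counts.
\<close>

lemma gap_exit: "gap n mu P xlet xcol = - 1"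
  and exit_column: "r < n \<Longrightarrow> xcol \<le> P (Suc (Suc xlet)) r \<Longrightarrow> xcol \<le> P (Suc xlet) r"
proof -
  have "mu (Suc xlet) \<le> mu xlet"
    using mu by (simp add: is_partition_def)
  then have "xcol \<noteq> 0"
    using gap_exit_neg by (auto simp: gap_def letters_left_def intro: ccontr)
  then obtain j where j: "xcol = Suc j"
    using not0_implies_Suc by blast
  have "\<not> exits n mu P j"
    using j not_less_Least[of j "exits n mu P"] by (simp add: exit_col_def)
  then have before: "0 \<le> gap n mu P xlet j"
    using exit_letter_less unfolding exits_def by (meson not_less)
  define S where "S i = {r. r < n \<and> P i r \<le> j \<and> j < P (Suc i) r}" for i
  have "gap n mu P xlet xcol = gap n mu P xlet j - int (card (S xlet)) + int (card (S (Suc xlet)))"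
    by (simp add: gap_def j letters_left_Suc exit_strips S_def)
  moreover have "card (S xlet) \<le> 1"
    unfolding S_def by (rule column_card_le_1[OF exit_strips(1)])
  ultimately have "gap n mu P xlet xcol = - 1" and "card (S (Suc xlet)) = 0"
    using before gap_exit_neg by linarith+
  then show "gap n mu P xlet xcol = - 1" by simp
  have "finite (S (Suc xlet))" by (simp add: S_def)
  with \<open>card (S (Suc xlet)) = 0\<close> have "S (Suc xlet) = {}" by simp
  then show "r < n \<Longrightarrow> xcol \<le> P (Suc (Suc xlet)) r \<Longrightarrow> xcol \<le> P (Suc xlet) r"
    by (auto simp: S_def j not_le Suc_le_eq)
qed

lemma reflect_chain_eq: "reflect_chain n mu P = P(Suc xlet := toggled)"
  by (simp add: reflect_chain_def Let_def)

text \<open>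
  The first \<open>xcol\<close> columns of the tableau are untouched, so the reflected path leaves the chamber at the
  same time and through the same wall. This is why the reflection is an involution.
\<close>

lemma gap_reflect:
  assumes "j \<le> xcol"
  shows "gap n mu (reflect_chain n mu P) i j = gap n mu P i j"
proof -
  have "min (reflect_chain n mu P m r) j = min (P m r) j" for m r
    using min_toggle[OF exit_strips assms] by (simp add: reflect_chain_eq)
  then show ?thesis
    by (simp add: gap_def letters_left_def)
qed

lemma exit_reflect:
  "exits n mu (reflect_chain n mu P) xcol"
  "exit_col n mu (reflect_chain n mu P) = xcol"
  "exit_letter n mu (reflect_chain n mu P) = xlet"
proof -
  have same: "exits n mu (reflect_chain n mu P) j \<longleftrightarrow> exits n mu P j" if "j \<le> xcol" for j
    using gap_reflect[OF that] by (simp add: exits_def)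
  have "exits n mu P xcol"
    unfolding exit_col_def using exit by (rule LeastI_ex)
  then show ex: "exits n mu (reflect_chain n mu P) xcol" using same by simp
  show col: "exit_col n mu (reflect_chain n mu P) = xcol"
    unfolding exit_col_def[of n mu "reflect_chain n mu P"]
  proof (rule Least_equality[of "exits n mu (reflect_chain n mu P)", OF ex])
    fix j assume "exits n mu (reflect_chain n mu P) j"
    then show "xcol \<le> j"
      using same[of j] not_less_Least[of j "exits n mu P"]
      by (metis exit_col_def nat_le_linear not_less)
  qed
  show "exit_letter n mu (reflect_chain n mu P) = xlet"
    unfolding exit_letter_def[of n mu "reflect_chain n mu P"] col
    using gap_reflect by (simp add: exit_letter_def)
qed

lemma reflect_reflect: "reflect_chain n mu (reflect_chain n mu P) = P"
  using toggle_toggle[OF exit_strips]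
  by (simp add: reflect_chain_def[of n mu "reflect_chain n mu P"] exit_reflect Let_def)
    (simp add: reflect_chain_eq)

text \<open>
  The letters \<open>i\<close> and \<open>i + 1\<close> exchange their numbers to the right of the exit column. In the columns
  up to it, \<open>i\<close> occurs \<open>mu i - mu (i + 1) + 1\<close> times more often than \<open>i + 1\<close>, since the gap there is
  \<open>-1\<close>; this is the constant by which the new contents differ from the exchanged old ones. In terms of
  \<open>tau - mu - \<delta>\<close> the change is a plain exchange of two coordinates.
\<close>

lemma reflect_in_chains:
  "reflect_chain n mu P \<in> strip_chains n n
     (tau(xlet := tau (Suc xlet) + int (mu xlet) - int (mu (Suc xlet)) + 1,
          Suc xlet := tau xlet - int (mu xlet) + int (mu (Suc xlet)) - 1))"
proof -
  note n = exit_letter_less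
  have size: "int (psize n (P (Suc i))) = int (psize n (P i)) + tau i"
    and zero: "\<And>r. r \<ge> n \<Longrightarrow> P (Suc i) r = 0" if "i < n" for i
    using P that by (auto simp: strip_chains_def strips_up_def)
  have toggled_zero: "toggled r = 0" if "r \<ge> n" for r
    using toggle_strips(2)[OF exit_strips, of xcol] zero[OF n that]
    by (simp add: hstrip_def) (metis le_zero_eq)
  have "int (psize n toggled) + int (psize n (P (Suc xlet))) = int (psize n (P xlet)) +
      int (psize n (P (Suc (Suc xlet)))) + letters_left n P xlet xcol - letters_left n P (Suc xlet) xcol"
    unfolding letters_left_def
    by (rule sum_toggle[OF exit_strips]) (use zero[OF n] exit_column in auto)
  then have toggled_size: "int (psize n toggled) =
      int (psize n (P xlet)) + tau (Suc xlet) + int (mu xlet) - int (mu (Suc xlet)) + 1"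
    using gap_exit size[OF n] by (simp add: gap_def)
  show ?thesis
    unfolding reflect_chain_eq strip_chains_def
  proof (intro CollectI conjI allI impI)
    fix i assume i: "i < n"
    have step: "P (Suc i) \<in> strips_up n (P i) (tau i)"
      using P i by (simp add: strip_chains_def)
    consider "i = xlet" | "i = Suc xlet" | "i \<noteq> xlet" "i \<noteq> Suc xlet" by blast
    then show "(P(Suc xlet := toggled)) (Suc i) \<in> strips_up n ((P(Suc xlet := toggled)) i)
      ((tau(xlet := tau (Suc xlet) + int (mu xlet) - int (mu (Suc xlet)) + 1,
          Suc xlet := tau xlet - int (mu xlet) + int (mu (Suc xlet)) - 1)) i)"
    proof cases
      case 1
      then show ?thesis
        using toggle_strips(1)[OF exit_strips] toggled_zero toggled_size by (simp add: strips_up_def)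
    next
      case 2
      then show ?thesis
        using toggle_strips(2)[OF exit_strips] zero[OF n] toggled_size size[OF n] size[of xlet] n
        by (simp add: strips_up_def)
    next
      case 3
      then show ?thesis using step by simp
    qed
  next
    show "(P(Suc xlet := toggled)) 0 = (\<lambda>_. 0)"
      using P by (simp add: strip_chains_def)
  next
    fix i assume "n < i"
    then show "(P(Suc xlet := toggled)) i = (\<lambda>_. 0)"
      using P n by (simp add: strip_chains_def)
  qed
qed

lemma reflect_shape: "reflect_chain n mu P n = P n"
  using exit_letter_less by (simp add: reflect_chain_eq)

end

text \<open>
  All columns have been read as soon as \<open>j\<close> exceeds every part of the chain, and then the gap is the one
  of the total content.
\<close>

lemma no_exit_total:
  assumes P: "P \<in> strip_chains n n tau" and "\<not> (\<exists>j. exits n mu P j)" and i: "Suc i < n"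
  shows "0 \<le> (int (mu i) - tau i) - (int (mu (Suc i)) - tau (Suc i))"
proof -
  define j where "j = (\<Sum>m\<le>n. psize n (P m))"
  have big: "P m r \<le> j" if "m \<le> n" "r < n" for m r
  proof -
    have "P m r \<le> psize n (P m)" using that by (rule_tac part_le_psize)
    also have "\<dots> \<le> j" unfolding j_def by (rule member_le_sum) (use that in auto)
    finally show ?thesis .
  qed
  have "letters_left n P m j = tau m" if "m < n" for m
  proof -
    have "letters_left n P m j = (\<Sum>r<n. int (P (Suc m) r) - int (P m r))"
      unfolding letters_left_def using big that by (intro sum.cong) (auto simp: min_absorb1)
    also have "\<dots> = int (psize n (P (Suc m))) - int (psize n (P m))"
      by (simp add: psize_def sum_subtractf)
    also have "\<dots> = tau m"
      using P that by (simp add: strip_chains_def strips_up_def)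
    finally show ?thesis .
  qed
  moreover have "0 \<le> gap n mu P i j"
    using assms(2) i unfolding exits_def by (meson not_less)
  ultimately show ?thesis
    using i by (simp add: gap_def)
qed

section \<open>Lengths of permutations\<close>

text \<open>
  Exchanging the adjacent values \<open>i\<close> and \<open>i + 1\<close> does not affect the order of any other pair of
  values, so the pair of their positions is the only one whose status as an inversion changes.
\<close>

lemma perm_length_transpose_less:
  assumes w: "w permutes {..<n}" and p: "w p = i" and q: "w q = Suc i" and "p < q" and i: "Suc i < n"
  shows "perm_length n (transpose i (Suc i) \<circ> w) = Suc (perm_length n w)"
proof -
  let ?I = "\<lambda>w. {(a, b). a < b \<and> b < n \<and> w b < (w a :: nat)}"
  have inj: "a = p \<longleftrightarrow> w a = i" "a = q \<longleftrightarrow> w a = Suc i" for a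
    using p q inj_eq[OF permutes_inj[OF w], of a p] inj_eq[OF permutes_inj[OF w], of a q] by simp_all
  have "q < n"
    using q i permutes_in_image[OF w, of q] by simp
  have "transpose i (Suc i) (w b) < transpose i (Suc i) (w a) \<longleftrightarrow> w b < w a \<or> a = p \<and> b = q"
    if "a < b" for a b
    using inj[of a] inj[of b] \<open>p < q\<close> that by (auto simp: transpose_def)
  then have "?I (transpose i (Suc i) \<circ> w) = insert (p, q) (?I w)"
    using \<open>q < n\<close> \<open>p < q\<close> by auto
  moreover have "(p, q) \<notin> ?I w"
    using p q by simp
  moreover have "finite (?I w)"
    by (rule finite_subset[of _ "{..<n} \<times> {..<n}"]) auto
  ultimately show ?thesis
    by (simp add: perm_length_def)
qed

lemma perm_length_transpose:
  assumes w: "w permutes {..<n}" and i: "Suc i < n"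
  defines "w' \<equiv> transpose i (Suc i) \<circ> w"
  shows "perm_length n w' = Suc (perm_length n w) \<or> perm_length n w = Suc (perm_length n w')"
proof -
  obtain p q where p: "w p = i" and q: "w q = Suc i"
    using permutes_surj[OF w] by (metis surj_def)
  then have "p \<noteq> q" by auto
  have w': "w' permutes {..<n}"
    unfolding w'_def using i by (intro permutes_compose[OF w] permutes_swap_id) auto
  show ?thesis
  proof (cases "p < q")
    case True
    then show ?thesis
      using perm_length_transpose_less[OF w p q _ i] by (simp add: w'_def)
  next
    case False
    have "w' q = i" "w' p = Suc i"
      using p q by (simp_all add: w'_def)
    moreover have "q < p"
      using False \<open>p \<noteq> q\<close> by simp
    ultimately have "perm_length n (transpose i (Suc i) \<circ> w') = Suc (perm_length n w')"
      by (rule perm_length_transpose_less[OF w' _ _ _ i])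
    moreover have "transpose i (Suc i) \<circ> w' = w"
      by (simp add: w'_def fun_eq_iff)
    ultimately show ?thesis by simp
  qed
qed

lemma perm_length_eq_0:
  assumes w: "w permutes {..<n}" and mono: "\<And>i. Suc i < n \<Longrightarrow> inv w i < inv w (Suc i)"
  shows "perm_length n w = 0"
proof -
  have less: "inv w i < inv w j" if "i < j" "j < n" for i j
    using that
  proof (induction j)
    case (Suc j)
    then show ?case
      using mono[of j] by (cases "i = j") auto
  qed simp
  have "\<not> (a < b \<and> b < n \<and> w b < w a)" for a b
  proof
    assume ab: "a < b \<and> b < n \<and> w b < w a"
    then have "w a < n"
      using permutes_in_image[OF w, of a] by simp
    then have "inv w (w b) < inv w (w a)"
      using ab less by blast
    then show False
      using ab permutes_inverses(2)[OF w] by simp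
  qed
  then have "{(a, b). a < b \<and> b < n \<and> w b < w a} = {}"
    by blast
  then show ?thesis
    unfolding perm_length_def by (simp only: card.empty)
qed

section \<open>Truncating a cancelling sum\<close>

text \<open>
  A sign-reversing involution that changes the length by exactly one matches elements of lengths \<open>m\<close>
  and \<open>m + 1\<close>. In the proof, \<open>U\<close> and \<open>D\<close> are the lower and the upper members of the matched pairs that
  satisfy the length bound, and \<open>W\<close> consists of the elements whose partner falls below it.
\<close>

lemma truncated_cancellation:
  fixes g :: "'a \<Rightarrow> 'b::comm_ring_1" and len :: "'a \<Rightarrow> nat"
  assumes fin: "finite E"
    and E: "\<And>e. e \<in> E \<Longrightarrow> f e \<in> E" and invol: "\<And>e. e \<in> E \<Longrightarrow> f (f e) = e"
    and g: "\<And>e. e \<in> E \<Longrightarrow> g (f e) = g e"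
    and len: "\<And>e. e \<in> E \<Longrightarrow> len (f e) = Suc (len e) \<or> len e = Suc (len (f e))"
  shows "(\<Sum>e | e \<in> E \<and> k \<le> len e. (-1) ^ (k + len e) * g e) =
    (\<Sum>e | e \<in> E \<and> len e = k \<and> k = Suc (len (f e)). g e)"
proof -
  let ?s = "\<lambda>e. (-1) ^ (k + len e) * g e"
  define U where "U = {e \<in> E. k \<le> len e \<and> len (f e) = Suc (len e)}"
  define D where "D = {e \<in> E. k \<le> len (f e) \<and> len e = Suc (len (f e))}"
  define W where "W = {e \<in> E. len e = k \<and> k = Suc (len (f e))}"
  have "e \<in> E \<and> k \<le> len e \<longleftrightarrow> e \<in> (U \<union> D) \<union> W" for e
    using len[of e] unfolding U_def D_def W_def Un_iff mem_Collect_eq by linarith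
  then have "{e. e \<in> E \<and> k \<le> len e} = (U \<union> D) \<union> W"
    by blast
  moreover have "finite U" "finite D" "finite W"
    using fin by (simp_all add: U_def D_def W_def)
  moreover have "\<not> (e \<in> U \<union> D \<and> e \<in> W)" "\<not> (e \<in> U \<and> e \<in> D)" for e
    unfolding U_def D_def W_def Un_iff mem_Collect_eq by linarith+
  then have "(U \<union> D) \<inter> W = {}" "U \<inter> D = {}"
    by blast+
  ultimately have "(\<Sum>e | e \<in> E \<and> k \<le> len e. ?s e) = sum ?s U + sum ?s D + sum ?s W"
    by (simp add: sum.union_disjoint)
  moreover have "sum ?s D = (\<Sum>e\<in>U. - ?s e)"
  proof (rule sum.reindex_bij_witness[where i = f and j = f])
    fix e assume "e \<in> D"
    then have e: "e \<in> E" and "k \<le> len (f e)" and l: "len e = Suc (len (f e))"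
      by (simp_all add: D_def)
    then show "f e \<in> U"
      by (simp add: U_def E invol)
    show "f (f e) = e"
      by (rule invol[OF e])
    show "- ((-1) ^ (k + len (f e)) * g (f e)) = (-1) ^ (k + len e) * g e"
      by (simp add: l g[OF e])
  next
    fix e assume "e \<in> U"
    then have e: "e \<in> E" and "k \<le> len e" and "len (f e) = Suc (len e)"
      by (simp_all add: U_def)
    then show "f e \<in> D"
      by (simp add: D_def E invol)
    show "f (f e) = e"
      by (rule invol[OF e])
  qed
  moreover have "sum ?s W = sum g W"
    by (rule sum.cong) (auto simp: W_def)
  ultimately show ?thesis
    by (simp add: W_def sum_negf)
qed

lemma schur_positive_sum:
  assumes "finite E" "\<And>e. e \<in> E \<Longrightarrow> is_partition n (sh e)"
  shows "schur_positive n (\<Sum>e\<in>E. schur n (sh e))"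
  unfolding schur_positive_def
proof (intro exI conjI)
  show "finite (sh ` E)" using assms(1) by simp
  show "\<forall>lam\<in>sh ` E. is_partition n lam \<and> (0 :: int) \<le> int (card {e \<in> E. sh e = lam})"
    using assms(2) by auto
  have "(\<Sum>e\<in>E. schur n (sh e)) = (\<Sum>lam\<in>sh ` E. \<Sum>e\<in>{e \<in> E. sh e = lam}. schur n (sh e))"
    by (rule sum.image_gen[OF assms(1)])
  also have "\<dots> = (\<Sum>lam\<in>sh ` E. of_int (int (card {e \<in> E. sh e = lam})) * schur n lam)"
    by (intro sum.cong refl) simp
  finally show "(\<Sum>e\<in>E. schur n (sh e)) =
      (\<Sum>lam\<in>sh ` E. of_int (int (card {e \<in> E. sh e = lam})) * schur n lam)" .
qed

section \<open>Schur positivity\<close>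

theorem theorem2:
  fixes n k :: nat and mu nu :: "nat \<Rightarrow> nat"
  assumes "0 < n"
    and "is_partition n mu"
    and "is_partition n nu"
    and "k \<le> n choose 2"
  shows "schur_positive n (truncated_sum n mu nu k)"
proof -
  \<comment> \<open>The index of \<open>h\<close> in the summand of \<open>w\<close> is \<open>mu + \<delta> + w u\<close>, and \<open>u\<close> is strictly increasing.\<close>
  define u where "u j = perm_act (longest_perm n) (\<lambda>l. int (nu l)) j - delta n j" for j
  define tau where "tau w i = int (mu i) + delta n i + perm_act w u i" for w i
  \<comment> \<open>The pairs \<open>(w, T)\<close>, and among them those whose path leaves the chamber.\<close>
  define S where "S = (SIGMA w:{w. w permutes {..<n}}. strip_chains n n (tau w))"
  define E where "E = {e \<in> S. \<exists>j. exits n mu (snd e) j}"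
  define len where "len e = perm_length n (fst e)" for e :: "(nat \<Rightarrow> nat) \<times> (nat \<Rightarrow> nat \<Rightarrow> nat)"
  define f where "f e = (transpose (exit_letter n mu (snd e)) (Suc (exit_letter n mu (snd e))) \<circ> fst e,
      reflect_chain n mu (snd e))" for e :: "(nat \<Rightarrow> nat) \<times> (nat \<Rightarrow> nat \<Rightarrow> nat)"
  let ?g = "\<lambda>e. schur n (snd e n)"
  have finS: "finite S"
    unfolding S_def by (intro finite_SigmaI finite_strip_chains finite_permutations) simp
  then have finE: "finite E" by (simp add: E_def)

  have "truncated_sum n mu nu k = (-1) ^ k * (\<Sum>w | w permutes {..<n} \<and> k \<le> perm_length n w.
      (-1) ^ perm_length n w * (\<Sum>P\<in>strip_chains n n (tau w). schur n (P n)))"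
    unfolding truncated_sum_def h_vec_def prod_complete_h_eq_sum_chains tau_def u_def by (rule refl)
  also have "\<dots> = (\<Sum>w | w permutes {..<n} \<and> k \<le> perm_length n w.
      \<Sum>P\<in>strip_chains n n (tau w). (-1) ^ (k + perm_length n w) * schur n (P n))"
    by (simp add: sum_distrib_left power_add mult.assoc)
  also have "\<dots> = (\<Sum>(w, P)\<in>(SIGMA w:{w. w permutes {..<n} \<and> k \<le> perm_length n w}.
      strip_chains n n (tau w)). (-1) ^ (k + perm_length n w) * schur n (P n))"
    by (rule sum.Sigma) (simp_all add: finite_permutations finite_strip_chains)
  also have "\<dots> = (\<Sum>e | e \<in> S \<and> k \<le> len e. (-1) ^ (k + len e) * ?g e)"
    by (rule sum.cong) (auto simp: S_def len_def)
  also have "\<dots> = (\<Sum>e\<in>{e. e \<in> S - E \<and> k \<le> len e} \<union> {e. e \<in> E \<and> k \<le> len e}. (-1) ^ (k + len e) * ?g e)"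
    by (rule sum.cong) (auto simp: E_def)
  also have "\<dots> = (\<Sum>e | e \<in> S - E \<and> k \<le> len e. (-1) ^ (k + len e) * ?g e) +
      (\<Sum>e | e \<in> E \<and> k \<le> len e. (-1) ^ (k + len e) * ?g e)"
    using finS finE by (intro sum.union_disjoint) auto
  \<comment> \<open>A path that stays in the chamber has a strictly dominant endpoint \<open>w (- u)\<close>. As \<open>- u\<close> is
  strictly dominant too, \<open>w\<close> has length \<open>0\<close>, and the bound \<open>k \<le> 0\<close> makes the sign positive.\<close>
  also have "(\<Sum>e | e \<in> S - E \<and> k \<le> len e. (-1) ^ (k + len e) * ?g e) =
      (\<Sum>e | e \<in> S - E \<and> k \<le> len e. ?g e)"
  proof (rule sum.cong[OF refl])
    fix e assume "e \<in> {e. e \<in> S - E \<and> k \<le> len e}"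
    then obtain w P where e: "e = (w, P)" and w: "w permutes {..<n}"
      and P: "P \<in> strip_chains n n (tau w)" and no: "\<not> (\<exists>j. exits n mu P j)" and k: "k \<le> len e"
      by (auto simp: S_def E_def)
    have u_mono: "u b \<le> u a" if "b \<le> a" "a < n" for a b
      using that \<open>is_partition n nu\<close>
      by (auto simp: u_def perm_act_longest delta_def is_partition_def intro!: add_mono)
    have "inv w i < inv w (Suc i)" if i: "Suc i < n" for i
    proof -
      have "inv w i < n"
        using permutes_in_image[OF permutes_inv[OF w], of i] i by simp
      moreover have "u (inv w i) < u (inv w (Suc i))"
        using no_exit_total[OF P no i] by (simp add: tau_def delta_def perm_act_def)
      ultimately show ?thesis
        using u_mono[of "inv w (Suc i)" "inv w i"] by (meson not_le)
    qed
    then have "len e = 0"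
      using perm_length_eq_0[OF w] by (simp add: len_def e)
    then show "(-1) ^ (k + len e) * ?g e = ?g e"
      using k by simp
  qed
  also have "(\<Sum>e | e \<in> E \<and> k \<le> len e. (-1) ^ (k + len e) * ?g e) =
      (\<Sum>e | e \<in> E \<and> len e = k \<and> k = Suc (len (f e)). ?g e)"
  proof (rule truncated_cancellation[OF finE])
    fix e assume eE: "e \<in> E"
    obtain w P where e: "e = (w, P)" by (cases e)
    have w: "w permutes {..<n}" and P: "P \<in> strip_chains n n (tau w)" and ex: "\<exists>j. exits n mu P j"
      using eE by (simp_all add: S_def E_def e)
    note facts = \<open>is_partition n mu\<close> P ex
    let ?i = "exit_letter n mu P"
    let ?w = "transpose ?i (Suc ?i) \<circ> w"
    have i: "Suc ?i < n" by (rule exit_letter_less[OF facts])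
    have w': "?w permutes {..<n}"
      using i by (intro permutes_compose[OF w] permutes_swap_id) auto
    have "inv ?w m = inv w (transpose ?i (Suc ?i) m)" for m
      using permutes_bij[OF w] by (simp add: o_inv_distrib)
    then have "tau ?w = (tau w)(?i := tau w (Suc ?i) + int (mu ?i) - int (mu (Suc ?i)) + 1,
        Suc ?i := tau w ?i - int (mu ?i) + int (mu (Suc ?i)) - 1)"
      by (auto simp: fun_eq_iff tau_def perm_act_def delta_def transpose_def)
    then have "f e \<in> S"
      using reflect_in_chains[OF facts] w' by (simp add: S_def f_def e)
    then show "f e \<in> E"
      using exit_reflect(1)[OF facts] by (auto simp: E_def f_def e)
    show "f (f e) = e"
      by (simp add: f_def e exit_reflect(3)[OF facts] reflect_reflect[OF facts] fun_eq_iff)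
    show "?g (f e) = ?g e"
      by (simp add: f_def e reflect_shape[OF facts])
    show "len (f e) = Suc (len e) \<or> len e = Suc (len (f e))"
      using perm_length_transpose[OF w i] by (simp add: len_def f_def e)
  qed
  also have "(\<Sum>e | e \<in> S - E \<and> k \<le> len e. ?g e) +
      (\<Sum>e | e \<in> E \<and> len e = k \<and> k = Suc (len (f e)). ?g e) =
      (\<Sum>e\<in>{e. e \<in> S - E \<and> k \<le> len e} \<union> {e. e \<in> E \<and> len e = k \<and> k = Suc (len (f e))}. ?g e)"
    using finS finE by (intro sum.union_disjoint[symmetric]) auto
  finally have sum_eq: "truncated_sum n mu nu k = \<dots>" .
  show ?thesis
    unfolding sum_eq
  proof (rule schur_positive_sum)
    show "finite ({e. e \<in> S - E \<and> k \<le> len e} \<union> {e. e \<in> E \<and> len e = k \<and> k = Suc (len (f e))})"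
      using finS finE by simp
  next
    fix e assume "e \<in> {e. e \<in> S - E \<and> k \<le> len e} \<union> {e. e \<in> E \<and> len e = k \<and> k = Suc (len (f e))}"
    then have "e \<in> S"
      by (auto simp: E_def)
    then have "snd e \<in> strip_chains n n (tau (fst e))"
      by (auto simp: S_def)
    then show "is_partition n (snd e n)"
      by (rule strip_chains_partition)
  qed
qed

end
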